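(* Assume $\frac hr\le\omega$. Then the catenary $\rho_0$ is the unique minimizer of $\mathcal E_0$ on $X$.
   Context: Fix $h,r>0$. Let $X=\{\rho\in W^{1,1}(-h,h):\ \rho>0 \text{ on }[-h,h],\ \rho(-h)=\rho(h)=r\}$ (continuous representatives) and $\mathcal E_0(\rho)=\int_{-h}^h\rho\sqrt{1+(\rho')^2}\,dx$. Let $\Xi$ be the unique positive solution of $\xi\tanh\frac1\xi+\mathrm{sech}^2\frac1\xi=\xi$, and $\omega=\frac{1}{\Xi\cosh(1/\Xi)}$. Under $h/r\le\omega$, let $\Pi_0>0$ be the largest solution of $r=\Pi\cosh\frac{h}{\Pi}$ and $\rho_0(x)=\Pi_0\cosh\frac{x}{\Pi_0}$ on $[-h,h]$. *)

theory Defs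
  imports "HOL-Analysis.Analysis"
begin

text \<open>Continuous representatives of W^{1,1}(a,b): functions that are indefinite
  integrals of an (absolutely) integrable function g on [a,b]; g is the weak derivative.\<close>
definition W11 :: "real \<Rightarrow> real \<Rightarrow> (real \<Rightarrow> real) \<Rightarrow> bool" where
  "W11 a b \<rho> \<longleftrightarrow> (\<exists>g. g absolutely_integrable_on {a..b} \<and>
      (\<forall>x\<in>{a..b}. \<rho> x = \<rho> a + integral {a..x} g))"

text \<open>A weak derivative (determined up to a null set, which does not affect E0).\<close>
definition weak_deriv :: "real \<Rightarrow> real \<Rightarrow> (real \<Rightarrow> real) \<Rightarrow> real \<Rightarrow> real" where
  "weak_deriv a b \<rho> = (SOME g. g absolutely_integrable_on {a..b} \<and>
      (\<forall>x\<in>{a..b}. \<rho> x = \<rho> a + integral {a..x} g))"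

definition admissible :: "real \<Rightarrow> real \<Rightarrow> (real \<Rightarrow> real) set" where
  "admissible h r = {\<rho>. W11 (-h) h \<rho> \<and> (\<forall>x\<in>{-h..h}. \<rho> x > 0) \<and> \<rho> (-h) = r \<and> \<rho> h = r}"

definition E0 :: "real \<Rightarrow> (real \<Rightarrow> real) \<Rightarrow> real" where
  "E0 h \<rho> = integral {-h..h} (\<lambda>x. \<rho> x * sqrt (1 + (weak_deriv (-h) h \<rho> x)\<^sup>2))"

definition sech :: "real \<Rightarrow> real" where "sech x = 1 / cosh x"

definition Xi :: real where
  "Xi = (THE \<xi>. \<xi> > 0 \<and> \<xi> * tanh (1/\<xi>) + (sech (1/\<xi>))\<^sup>2 = \<xi>)"

definition omega :: real where
  "omega = 1 / (Xi * cosh (1 / Xi))"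

definition Pi0 :: "real \<Rightarrow> real \<Rightarrow> real" where
  "Pi0 h r = (GREATEST p. p > 0 \<and> r = p * cosh (h / p))"

definition rho0 :: "real \<Rightarrow> real \<Rightarrow> real \<Rightarrow> real" where
  "rho0 h r x = Pi0 h r * cosh (x / Pi0 h r)"

end

theory Submission
  imports Defs
begin

text \<open>The catenaries y = P cosh (x / P) foliate the cone |x| < y / cosh 1 around the y-axis,
  and the energy calib x y of the arc from the y-axis to (x, y) is a calibration: its gradient has
  norm y, so its increment along a graph is at most the energy, with equality only if the graph
  follows the field. The condition h / r \<le> omega says precisely that calib h r \<le> r^2 / 2.
  A competitor on [0, h] that leaves the cone x \<le> omega * y crosses its boundary, where
  calib x y = y^2 / 2; between the first and the last crossing the trivial bound by the increment of
  y^2 / 2 is strict, so such a competitor has larger energy. The two halves of [-h, h]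
  are treated separately, by reflection.\<close>

section \<open>Calculus of indefinite integrals\<close>

text \<open>Competitors lie only in W^{1,1}, so they have no pointwise derivative to feed into a
  calibration. A function is therefore always carried together with an integrable density, and chain
  and product rules are proved for such pairs from continuity alone. The energy and its potentials
  are homogeneous in (x, y), so everything reduces to functions of the single ratio x / y, that is,
  of the parameter t = x / P. The second potential y^2 / 2 has the vertical gradient (0, y), again
  of norm y. It bounds the energy wherever y > 0, even where no catenary of the field passes, and
  the ray x = \<open>omega\<close> * y is where it agrees with \<open>calib\<close>; that is why the
  estimates inside and outside the cone can be glued there. Equality in the calibration gives the
  slope equation g = sinh t only almost everywhere. Instead of a uniqueness theorem for this
  differential equation, the waist f / cosh t is shown to have zero density; it is then constant and
  determines f.\<close>

definition has_ac_deriv :: "(real \<Rightarrow> real) \<Rightarrow> (real \<Rightarrow> real) \<Rightarrow> real \<Rightarrow> real \<Rightarrow> bool" where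
  "has_ac_deriv f g a b \<longleftrightarrow> g absolutely_integrable_on {a..b} \<and>
     (\<forall>x\<in>{a..b}. f x = f a + integral {a..x} g)"

text \<open>Errors bounded by \<open>e\<close> times an additive quantity can be summed, so
  bisection (\<open>Bolzano\<close>) turns the local bounds into a global one, and \<open>e\<close>
  is arbitrary. This takes the place of differentiating \<open>F\<close>; the weight
  \<open>w\<close> will be the absolute value of a weak derivative.\<close>

lemma increment_eq_integralI:
  fixes F k w :: "real \<Rightarrow> real"
  assumes "a \<le> b" and k: "k integrable_on {a..b}" and w: "w integrable_on {a..b}"
    and loc: "\<And>e x. e > 0 \<Longrightarrow> x \<in> {a..b} \<Longrightarrow>
      \<exists>d>0. \<forall>u v. a \<le> u \<and> u \<le> x \<and> x \<le> v \<and> v \<le> b \<and> v - u < d \<longrightarrow>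
        \<bar>F v - F u - integral {u..v} k\<bar> \<le> e * integral {u..v} w"
  shows "F b - F a = integral {a..b} k"
proof -
  have bound: "\<bar>F b - F a - integral {a..b} k\<bar> \<le> e * integral {a..b} w" if "e > 0" for e
  proof -
    define P where "P u v \<longleftrightarrow> (a \<le> u \<longrightarrow> v \<le> b \<longrightarrow>
        \<bar>F v - F u - integral {u..v} k\<bar> \<le> e * integral {u..v} w)" for u v
    have "P a b"
    proof (rule Bolzano[OF \<open>a \<le> b\<close>])
      fix u v z assume P: "P u v" "P v z" and le: "u \<le> v" "v \<le> z"
      show "P u z" unfolding P_def
      proof (intro impI)
        assume uz: "a \<le> u" "z \<le> b"
        have sub: "{u..z} \<subseteq> {a..b}" using uz by auto
        have "integral {u..v} k + integral {v..z} k = integral {u..z} k"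
          "integral {u..v} w + integral {v..z} w = integral {u..z} w"
          using le by (intro Henstock_Kurzweil_Integration.integral_combine
            integrable_on_subinterval[OF _ sub] k w; simp)+
        moreover from P uz le have "\<bar>F v - F u - integral {u..v} k\<bar> \<le> e * integral {u..v} w"
          "\<bar>F z - F v - integral {v..z} k\<bar> \<le> e * integral {v..z} w"
          unfolding P_def by auto
        moreover have "e * (integral {u..v} w + integral {v..z} w) =
            e * integral {u..v} w + e * integral {v..z} w" by (simp add: algebra_simps)
        ultimately show "\<bar>F z - F u - integral {u..z} k\<bar> \<le> e * integral {u..z} w"
          by (smt (verit))
      qed
    next
      fix x assume "a \<le> x" "x \<le> b"
      with loc[OF that, of x] show "\<exists>d>0. \<forall>u v. u \<le> x \<and> x \<le> v \<and> v - u < d \<longrightarrow> P u v"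
        unfolding P_def by (meson atLeastAtMost_iff)
    qed
    then show ?thesis by (simp add: P_def)
  qed
  have "\<bar>F b - F a - integral {a..b} k\<bar> \<le> 0"
  proof (rule field_le_epsilon)
    fix e :: real assume "e > 0"
    define W where "W = \<bar>integral {a..b} w\<bar> + 1"
    have "W > 0" unfolding W_def by simp
    have "\<bar>F b - F a - integral {a..b} k\<bar> \<le> e / W * integral {a..b} w"
      using bound[of "e / W"] \<open>e > 0\<close> \<open>W > 0\<close> by simp
    also have "\<dots> \<le> e / W * W"
      using \<open>e > 0\<close> \<open>W > 0\<close> by (intro mult_left_mono) (auto simp: W_def)
    finally show "\<bar>F b - F a - integral {a..b} k\<bar> \<le> 0 + e" using \<open>W > 0\<close> by simp
  qed
  then show ?thesis by simp
qed

lemma has_ac_deriv_increment: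
  assumes "has_ac_deriv f g a b" "a \<le> u" "u \<le> v" "v \<le> b"
  shows "f v - f u = integral {u..v} g"
proof -
  have g: "g integrable_on {a..v}"
    using assms by (auto simp: has_ac_deriv_def absolutely_integrable_on_def
        intro: integrable_on_subinterval)
  have "f v = f a + integral {a..v} g" "f u = f a + integral {a..u} g"
    using assms unfolding has_ac_deriv_def by (meson atLeastAtMost_iff order_trans)+
  moreover have "integral {a..u} g + integral {u..v} g = integral {a..v} g"
    using assms g by (intro Henstock_Kurzweil_Integration.integral_combine) auto
  ultimately show ?thesis by simp
qed

lemma has_ac_derivI:
  assumes "g absolutely_integrable_on {a..b}"
    and "\<And>x. a \<le> x \<Longrightarrow> x \<le> b \<Longrightarrow> f x - f a = integral {a..x} g"
  shows "has_ac_deriv f g a b"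
  using assms by (force simp: has_ac_deriv_def)

lemma has_ac_deriv_subinterval:
  assumes "has_ac_deriv f g a b" "a \<le> c" "d \<le> b"
  shows "has_ac_deriv f g c d"
proof (rule has_ac_derivI)
  show "g absolutely_integrable_on {c..d}"
    using assms by (auto simp: has_ac_deriv_def intro: absolutely_integrable_on_subinterval)
qed (use assms in \<open>auto intro!: has_ac_deriv_increment[where a=a and b=b]\<close>)

lemma has_ac_deriv_abs_integrable:
  "has_ac_deriv f g a b \<Longrightarrow> g absolutely_integrable_on {a..b}"
  by (simp add: has_ac_deriv_def)

lemma has_ac_deriv_continuous:
  assumes "has_ac_deriv f g a b"
  shows "continuous_on {a..b} f"
proof -
  have "continuous_on {a..b} (\<lambda>x. f a + integral {a..x} g)"
    using assms by (intro continuous_intros indefinite_integral_continuous_1)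
      (auto simp: has_ac_deriv_def absolutely_integrable_on_def)
  moreover have "f x = f a + integral {a..x} g" if "x \<in> {a..b}" for x
    using assms that unfolding has_ac_deriv_def by blast
  ultimately show ?thesis by (metis (no_types, lifting) continuous_on_cong)
qed

lemma abs_integrable_mult_continuous:
  fixes p g :: "real \<Rightarrow> real"
  assumes "continuous_on {a..b} p" "g absolutely_integrable_on {a..b}"
  shows "(\<lambda>x. p x * g x) absolutely_integrable_on {a..b}"
  using assms
  by (intro absolutely_integrable_bounded_measurable_product_real)
    (auto intro: continuous_imp_measurable_on_sets_lebesgue compact_imp_bounded compact_continuous_image)

text \<open>Freezing the continuous factor costs its oscillation times the integral of |g|, which is
  the form of error that \<open>increment_eq_integralI\<close> accepts.\<close>

lemma integral_continuous_mult_close: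
  fixes p g :: "real \<Rightarrow> real"
  assumes p: "continuous_on {u..v} p" and g: "g absolutely_integrable_on {u..v}"
    and close: "\<And>s. s \<in> {u..v} \<Longrightarrow> \<bar>c - p s\<bar> \<le> e"
  shows "\<bar>c * integral {u..v} g - integral {u..v} (\<lambda>s. p s * g s)\<bar> \<le> e * integral {u..v} (\<lambda>s. \<bar>g s\<bar>)"
proof -
  have gi: "g integrable_on {u..v}" and ga: "(\<lambda>s. \<bar>g s\<bar>) integrable_on {u..v}"
    using g by (auto simp: absolutely_integrable_on_def)
  have pg: "(\<lambda>s. p s * g s) integrable_on {u..v}"
    using abs_integrable_mult_continuous[OF p g] by (auto simp: absolutely_integrable_on_def)
  have "c * integral {u..v} g - integral {u..v} (\<lambda>s. p s * g s) =
      integral {u..v} (\<lambda>s. c * g s - p s * g s)"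
    using gi pg by (subst Henstock_Kurzweil_Integration.integral_diff) (auto intro: integrable_on_mult_right)
  also have "norm \<dots> \<le> integral {u..v} (\<lambda>s. e * \<bar>g s\<bar>)"
  proof (rule Henstock_Kurzweil_Integration.integral_norm_bound_integral)
    show "(\<lambda>s. c * g s - p s * g s) integrable_on {u..v}"
      using gi pg by (intro Henstock_Kurzweil_Integration.integrable_diff integrable_on_mult_right)
    show "(\<lambda>s. e * \<bar>g s\<bar>) integrable_on {u..v}" using ga by (rule integrable_on_mult_right)
    show "norm (c * g s - p s * g s) \<le> e * \<bar>g s\<bar>" if "s \<in> {u..v}" for s
      using mult_right_mono[OF close[OF that], of "\<bar>g s\<bar>"]
      by (simp add: abs_mult[symmetric] algebra_simps)
  qed
  finally show ?thesis by simp
qed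

lemma continuous_on_local_bound:
  fixes p :: "real \<Rightarrow> real"
  assumes "continuous_on {a..b} p" "x \<in> {a..b}" "e > 0"
  obtains d where "d > 0"
    "\<And>u v s t. a \<le> u \<Longrightarrow> u \<le> x \<Longrightarrow> x \<le> v \<Longrightarrow> v \<le> b \<Longrightarrow> v - u < d \<Longrightarrow> s \<in> {u..v} \<Longrightarrow> t \<in> {u..v} \<Longrightarrow>
      \<bar>p s - p t\<bar> \<le> e"
proof -
  obtain d where d: "d > 0" "\<And>y. y \<in> {a..b} \<Longrightarrow> dist y x < d \<Longrightarrow> dist (p y) (p x) < e / 2"
    using assms unfolding continuous_on_iff by (metis half_gt_zero)
  show thesis
  proof (rule that[OF d(1)])
    fix u v s t :: real
    assume *: "a \<le> u" "u \<le> x" "x \<le> v" "v \<le> b" "v - u < d" "s \<in> {u..v}" "t \<in> {u..v}"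
    have "dist (p s) (p x) < e / 2" "dist (p t) (p x) < e / 2"
      by (rule d(2); use * in \<open>auto simp: dist_real_def\<close>)+
    then show "\<bar>p s - p t\<bar> \<le> e" unfolding dist_real_def by linarith
  qed
qed

text \<open>Only \<open>p\<close> is differentiated: the mean value theorem handles its increment
  between f u and f v, and continuity of p' along f makes the error small relative to the integral
  of |g|.\<close>

lemma has_ac_deriv_compose:
  fixes p p' :: "real \<Rightarrow> real"
  assumes f: "has_ac_deriv f g a b"
    and p: "\<And>y. y \<in> S \<Longrightarrow> (p has_real_derivative p' y) (at y)"
    and p': "continuous_on S p'"
    and S: "is_interval S" "f ` {a..b} \<subseteq> S"
  shows "has_ac_deriv (\<lambda>x. p (f x)) (\<lambda>x. p' (f x) * g x) a b"
proof (rule has_ac_derivI)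
  have fc: "continuous_on {a..b} f" using f by (rule has_ac_deriv_continuous)
  have pc: "continuous_on {a..b} (\<lambda>x. p' (f x))"
    using p' S fc by (metis continuous_on_compose2)
  have g: "g absolutely_integrable_on {a..b}" using f by (rule has_ac_deriv_abs_integrable)
  show "(\<lambda>x. p' (f x) * g x) absolutely_integrable_on {a..b}"
    by (rule abs_integrable_mult_continuous[OF pc g])
  fix c assume c: "a \<le> c" "c \<le> b"
  have sub: "{a..c} \<subseteq> {a..b}" using c by auto
  have fcc: "continuous_on {a..c} f" and pcc: "continuous_on {a..c} (\<lambda>x. p' (f x))"
    using fc pc sub by (auto intro: continuous_on_subset)
  show "p (f c) - p (f a) = integral {a..c} (\<lambda>x. p' (f x) * g x)"
  proof (rule increment_eq_integralI[OF c(1), where w="\<lambda>x. \<bar>g x\<bar>"])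
    show "(\<lambda>x. p' (f x) * g x) integrable_on {a..c}"
      using abs_integrable_mult_continuous[OF pc g] sub
      by (auto simp: absolutely_integrable_on_def intro: integrable_on_subinterval)
    show "(\<lambda>x. \<bar>g x\<bar>) integrable_on {a..c}"
      using g sub by (auto simp: absolutely_integrable_on_def intro: integrable_on_subinterval)
    fix e x :: real assume e: "e > 0" and x: "x \<in> {a..c}"
    obtain d where d: "d > 0"
      "\<And>u v s t. a \<le> u \<Longrightarrow> u \<le> x \<Longrightarrow> x \<le> v \<Longrightarrow> v \<le> c \<Longrightarrow> v - u < d \<Longrightarrow> s \<in> {u..v} \<Longrightarrow> t \<in> {u..v} \<Longrightarrow>
        \<bar>p' (f s) - p' (f t)\<bar> \<le> e"
      using continuous_on_local_bound[OF pcc x e] by metis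
    have "\<bar>p (f v) - p (f u) - integral {u..v} (\<lambda>x. p' (f x) * g x)\<bar> \<le> e * integral {u..v} (\<lambda>x. \<bar>g x\<bar>)"
      if uv: "a \<le> u" "u \<le> x" "x \<le> v" "v \<le> c" "v - u < d" for u v
    proof -
      have uvs: "{u..v} \<subseteq> {a..c}" "{u..v} \<subseteq> {a..b}" using uv c by auto
      have ffS: "f u \<in> S" "f v \<in> S" using S uvs uv c by auto
      have "\<exists>\<eta>. (\<eta> \<in> closed_segment (f u) (f v)) \<and> p (f v) - p (f u) = p' \<eta> * (f v - f u)"
      proof -
        have seg: "closed_segment (f u) (f v) \<subseteq> S"
          using S(1) ffS by (simp add: closed_segment_subset is_interval_convex)
        consider "f u < f v" | "f u = f v" | "f v < f u" by linarith
        then show ?thesis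
        proof cases
          case 1
          obtain z where "f u < z" "z < f v" "p (f v) - p (f u) = (f v - f u) * p' z"
            using MVT2[OF 1, of p p'] p seg 1 by (force simp: closed_segment_eq_real_ivl)
          then show ?thesis using 1
            by (intro exI[of _ z]) (auto simp: closed_segment_eq_real_ivl)
        next
          case 2
          then show ?thesis by auto
        next
          case 3
          obtain z where "f v < z" "z < f u" "p (f u) - p (f v) = (f u - f v) * p' z"
            using MVT2[OF 3, of p p'] p seg 3 by (force simp: closed_segment_eq_real_ivl)
          then show ?thesis using 3
            by (intro exI[of _ z]) (auto simp: closed_segment_eq_real_ivl algebra_simps)
        qed
      qed
      then obtain \<eta> where \<eta>: "\<eta> \<in> closed_segment (f u) (f v)"
        "p (f v) - p (f u) = p' \<eta> * (f v - f u)" by blast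
      \<comment> \<open>The intermediate point of the mean value theorem lies between f u and f v,
        hence is a value f s with s in [u, v]. Only then can p' at that point be compared with p'
        along f by the local bound.\<close>
      have "connected (f ` {u..v})"
        using fcc uvs by (intro connected_continuous_image) (auto intro: continuous_on_subset)
      then have "is_interval (f ` {u..v})" by (simp add: is_interval_connected_1)
      then have "closed_segment (f u) (f v) \<subseteq> f ` {u..v}"
        using uv by (intro closed_segment_subset) (auto simp: is_interval_convex)
      then obtain s where s: "s \<in> {u..v}" "f s = \<eta>" using \<eta>(1) by auto
      have "f v - f u = integral {u..v} g"
        using uv c by (intro has_ac_deriv_increment[OF f]) auto
      moreover have "\<bar>p' (f s) * integral {u..v} g - integral {u..v} (\<lambda>s. p' (f s) * g s)\<bar>
          \<le> e * integral {u..v} (\<lambda>s. \<bar>g s\<bar>)"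
      proof (rule integral_continuous_mult_close)
        show "continuous_on {u..v} (\<lambda>s. p' (f s))" using pcc uvs by (auto intro: continuous_on_subset)
        show "g absolutely_integrable_on {u..v}"
          using g uvs by (auto intro: absolutely_integrable_on_subinterval)
        show "\<bar>p' (f s) - p' (f t)\<bar> \<le> e" if "t \<in> {u..v}" for t
          using d(2)[of u v s t] uv s that by blast
      qed
      ultimately show ?thesis using \<eta>(2) s(2) by simp
    qed
    then show "\<exists>d>0. \<forall>u v. a \<le> u \<and> u \<le> x \<and> x \<le> v \<and> v \<le> c \<and> v - u < d \<longrightarrow>
        \<bar>p (f v) - p (f u) - integral {u..v} (\<lambda>x. p' (f x) * g x)\<bar> \<le> e * integral {u..v} (\<lambda>x. \<bar>g x\<bar>)"
      using d(1) by blast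
  qed
qed

lemma has_ac_deriv_add:
  assumes "has_ac_deriv f f' a b" "has_ac_deriv g g' a b"
  shows "has_ac_deriv (\<lambda>x. f x + g x) (\<lambda>x. f' x + g' x) a b"
proof (rule has_ac_derivI)
  show "(\<lambda>x. f' x + g' x) absolutely_integrable_on {a..b}"
    using assms by (auto simp: has_ac_deriv_def intro: set_integral_add)
  fix x assume x: "a \<le> x" "x \<le> b"
  have "f' integrable_on {a..x}" "g' integrable_on {a..x}"
    using assms x by (auto simp: has_ac_deriv_def absolutely_integrable_on_def
        intro: integrable_on_subinterval)
  then show "f x + g x - (f a + g a) = integral {a..x} (\<lambda>x. f' x + g' x)"
    using has_ac_deriv_increment[OF assms(1), of a x] has_ac_deriv_increment[OF assms(2), of a x] x
    by (simp add: Henstock_Kurzweil_Integration.integral_add)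
qed

lemma has_ac_deriv_cmult:
  assumes "has_ac_deriv f f' a b"
  shows "has_ac_deriv (\<lambda>x. c * f x) (\<lambda>x. c * f' x) a b"
proof (rule has_ac_derivI)
  show "(\<lambda>x. c * f' x) absolutely_integrable_on {a..b}"
    using assms by (auto simp: has_ac_deriv_def intro: set_integrable_mult_right)
  fix x assume x: "a \<le> x" "x \<le> b"
  show "c * f x - c * f a = integral {a..x} (\<lambda>x. c * f' x)"
    using has_ac_deriv_increment[OF assms(1), of a x] x by (simp add: algebra_simps flip: right_diff_distrib)
qed

text \<open>Polarization: f g = ((f + g)^2 - (f - g)^2) / 4, so the chain rule for the square
  suffices.\<close>

lemma has_ac_deriv_mult:
  assumes f: "has_ac_deriv f f' a b" and g: "has_ac_deriv g g' a b"
  shows "has_ac_deriv (\<lambda>x. f x * g x) (\<lambda>x. f' x * g x + f x * g' x) a b"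
proof -
  have sq: "has_ac_deriv (\<lambda>x. (h x)\<^sup>2) (\<lambda>x. 2 * h x * h' x) a b" if "has_ac_deriv h h' a b" for h h'
    by (rule has_ac_deriv_compose[OF that, where S=UNIV])
      (auto intro!: derivative_eq_intros continuous_intros)
  have "has_ac_deriv (\<lambda>x. (1/4) * (f x + g x)\<^sup>2 + (-1/4) * (f x + (-1) * g x)\<^sup>2)
     (\<lambda>x. (1/4) * (2 * (f x + g x) * (f' x + g' x)) + (-1/4) * (2 * (f x + (-1) * g x) * (f' x + (-1) * g' x))) a b"
    by (intro has_ac_deriv_add[OF has_ac_deriv_cmult has_ac_deriv_cmult] sq has_ac_deriv_add
        has_ac_deriv_cmult f g)
  moreover have "(\<lambda>x. (1/4) * (f x + g x)\<^sup>2 + (-1/4) * (f x + (-1) * g x)\<^sup>2) = (\<lambda>x. f x * g x)"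
    by (simp add: fun_eq_iff power2_eq_square algebra_simps)
  moreover have "(\<lambda>x. (1/4) * (2 * (f x + g x) * (f' x + g' x)) +
      (-1/4) * (2 * (f x + (-1) * g x) * (f' x + (-1) * g' x))) = (\<lambda>x. f' x * g x + f x * g' x)"
    by (simp add: fun_eq_iff algebra_simps)
  ultimately show ?thesis by (simp only:)
qed

section \<open>Almost everywhere uniqueness of the weak derivative\<close>

lemma nonneg_integral_zero_imp_negligible:
  fixes d :: "real \<Rightarrow> real"
  assumes d: "d integrable_on S" "integral S d = 0" and pos: "\<And>x. x \<in> S \<Longrightarrow> 0 \<le> d x"
  shows "negligible {x \<in> S. d x \<noteq> 0}"
proof -
  have di: "d absolutely_integrable_on S"
    using d(1) pos by (rule nonnegative_absolutely_integrable_1)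
  then have i: "integrable lebesgue (\<lambda>x. indicat_real S x *\<^sub>R d x)" by (simp add: set_integrable_def)
  have "integral\<^sup>L lebesgue (\<lambda>x. indicat_real S x *\<^sub>R d x) = 0"
    using set_lebesgue_integral_eq_integral(2)[OF di] d(2) by (simp add: set_lebesgue_integral_def)
  then have "AE x in lebesgue. indicat_real S x *\<^sub>R d x = 0"
    using integral_nonneg_eq_0_iff_AE[OF i] pos by (auto simp: indicator_def)
  then have "{x. indicat_real S x *\<^sub>R d x \<noteq> 0} \<in> null_sets lebesgue"
    unfolding completion.AE_iff_null_sets by simp
  moreover have "{x. indicat_real S x *\<^sub>R d x \<noteq> 0} = {x \<in> S. d x \<noteq> 0}"
    by (auto simp: indicator_def)
  ultimately show ?thesis by (simp only: negligible_iff_null_sets)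
qed

text \<open>The density \<open>d\<close> integrates to 0 over every subinterval; freezing
  \<open>p\<close> locally extends this to continuous weights, by
  \<open>increment_eq_integralI\<close> with \<open>F\<close> constantly 0.\<close>

lemma integral_mult_continuous_eq_0:
  fixes p d :: "real \<Rightarrow> real"
  assumes "a \<le> b" and p: "continuous_on {a..b} p" and d: "has_ac_deriv (\<lambda>_. 0) d a b"
  shows "integral {a..b} (\<lambda>x. p x * d x) = 0"
proof -
  have da: "d absolutely_integrable_on {a..b}" using d by (rule has_ac_deriv_abs_integrable)
  have "(0::real) - 0 = integral {a..b} (\<lambda>x. p x * d x)"
  proof (rule increment_eq_integralI[where F="\<lambda>_. 0" and w="\<lambda>x. \<bar>d x\<bar>"])
    show "(\<lambda>x. p x * d x) integrable_on {a..b}" "(\<lambda>x. \<bar>d x\<bar>) integrable_on {a..b}"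
      using abs_integrable_mult_continuous[OF p da] da by (auto simp: absolutely_integrable_on_def)
    fix e x :: real assume e: "e > 0" and x: "x \<in> {a..b}"
    obtain \<delta> where \<delta>: "\<delta> > 0"
      "\<And>u v s t. a \<le> u \<Longrightarrow> u \<le> x \<Longrightarrow> x \<le> v \<Longrightarrow> v \<le> b \<Longrightarrow> v - u < \<delta> \<Longrightarrow> s \<in> {u..v} \<Longrightarrow> t \<in> {u..v} \<Longrightarrow>
        \<bar>p s - p t\<bar> \<le> e"
      using continuous_on_local_bound[OF p x e] by metis
    have "\<bar>0 - 0 - integral {u..v} (\<lambda>x. p x * d x)\<bar> \<le> e * integral {u..v} (\<lambda>x. \<bar>d x\<bar>)"
      if uv: "a \<le> u" "u \<le> x" "x \<le> v" "v \<le> b" "v - u < \<delta>" for u v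
    proof -
      have "\<bar>p x * integral {u..v} d - integral {u..v} (\<lambda>s. p s * d s)\<bar>
          \<le> e * integral {u..v} (\<lambda>s. \<bar>d s\<bar>)"
      proof (rule integral_continuous_mult_close)
        show "continuous_on {u..v} p" using p uv by (auto intro: continuous_on_subset)
        show "d absolutely_integrable_on {u..v}"
          using da uv by (auto intro: absolutely_integrable_on_subinterval)
        show "\<bar>p x - p s\<bar> \<le> e" if "s \<in> {u..v}" for s
          using \<delta>(2)[of u v x s] uv that by auto
      qed
      moreover have "integral {u..v} d = 0"
        using has_ac_deriv_increment[OF d, of u v] uv by auto
      ultimately show ?thesis by simp
    qed
    then show "\<exists>\<delta>>0. \<forall>u v. a \<le> u \<and> u \<le> x \<and> x \<le> v \<and> v \<le> b \<and> v - u < \<delta> \<longrightarrow>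
        \<bar>0 - 0 - integral {u..v} (\<lambda>x. p x * d x)\<bar> \<le> e * integral {u..v} (\<lambda>x. \<bar>d x\<bar>)"
      using \<delta>(1) by blast
  qed (use assms in auto)
  then show ?thesis by simp
qed

lemma has_ac_deriv_zero_negligible:
  assumes "a \<le> b" and d: "has_ac_deriv (\<lambda>_. 0) d a b"
  shows "negligible {x \<in> {a..b}. d x \<noteq> 0}"
proof -
  have da: "d absolutely_integrable_on {a..b}" using d by (rule has_ac_deriv_abs_integrable)
  have dabs: "(\<lambda>x. \<bar>d x\<bar>) integrable_on {a..b}"
    using da by (simp add: absolutely_integrable_on_def)
  have "d \<in> borel_measurable (lebesgue_on {a..b})"
    using da by (simp add: absolutely_integrable_measurable)
  then have "d measurable_on {a..b}" by (simp add: measurable_on_iff_borel_measurable)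
  then obtain N G where N: "negligible N" and G: "\<And>n. continuous_on UNIV (G n)"
    and lim: "\<And>x. x \<notin> N \<Longrightarrow> (\<lambda>n. G n x) \<longlonglongrightarrow> (if x \<in> {a..b} then d x else 0)"
    unfolding measurable_on_def by blast
  text \<open>Testing against the bounded continuous functions p n, which tend to d / (1 + |d|)
    almost everywhere, avoids the Lebesgue differentiation theorem.\<close>
  define p where "p n x = G n x / (1 + \<bar>G n x\<bar>)" for n :: nat and x
  have pc: "continuous_on A (p n)" for n A
  proof -
    have "continuous_on A (G n)" using G by (rule continuous_on_subset) simp
    then show ?thesis unfolding p_def by (intro continuous_intros) (auto simp: add_nonneg_eq_0_iff)
  qed
  have zero: "integral {a..b} (\<lambda>x. p n x * d x) = 0" for n
    by (rule integral_mult_continuous_eq_0[OF assms(1) pc d])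
  \<comment> \<open>\<open>dominated_convergence\<close> asks for convergence at every point, so the
    exceptional null set is removed from the domain.\<close>
  define T where "T = {a..b} - N"
  define D where "D x = d x / (1 + \<bar>d x\<bar>) * d x" for x
  have sym: "negligible ({x \<in> {a..b} - T. f x \<noteq> 0})" "negligible {x \<in> T - {a..b}. f x \<noteq> 0}" for f :: "real \<Rightarrow> real"
    by (rule negligible_subset[OF N]; force simp: T_def)+
  have pi: "(\<lambda>x. p n x * d x) integrable_on T" for n
    using abs_integrable_mult_continuous[OF pc da, of n]
    by (auto simp: absolutely_integrable_on_def intro: integrable_spike_set[OF _ sym])
  have p_int: "integral T (\<lambda>x. p n x * d x) = 0" for n
    using zero[of n] integral_spike_set[OF sym, of "\<lambda>x. p n x * d x"] by simp
  have dT: "(\<lambda>x. \<bar>d x\<bar>) integrable_on T" by (rule integrable_spike_set[OF dabs sym])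
  have le: "norm (p n x * d x) \<le> \<bar>d x\<bar>" for n x
  proof -
    have "\<bar>p n x\<bar> \<le> 1" by (simp add: p_def abs_mult)
    then show ?thesis by (simp add: abs_mult mult_left_le_one_le)
  qed
  have lim': "(\<lambda>n. p n x * d x) \<longlonglongrightarrow> D x" if "x \<in> T" for x
  proof -
    have "(\<lambda>n. G n x) \<longlonglongrightarrow> d x" using lim[of x] that by (auto simp: T_def)
    then show ?thesis unfolding p_def D_def by (intro tendsto_intros) (auto simp: add_nonneg_eq_0_iff)
  qed
  have "D integrable_on T" "(\<lambda>n. integral T (\<lambda>x. p n x * d x)) \<longlonglongrightarrow> integral T D"
    using dominated_convergence[OF pi dT le lim'] by auto
  then have D: "D integrable_on T" "integral T D = 0"
    unfolding p_int by (auto intro: LIMSEQ_unique)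
  \<comment> \<open>\<open>D\<close> equals d^2 / (1 + |d|): it is nonnegative and vanishes only
    where \<open>d\<close> does.\<close>
  have "negligible {x \<in> T. D x \<noteq> 0}"
    by (rule nonneg_integral_zero_imp_negligible[OF D]) (simp add: D_def)
  then have "negligible ({x \<in> T. D x \<noteq> 0} \<union> N)" using N by simp
  then show ?thesis
    by (rule negligible_subset) (auto simp: T_def D_def add_nonneg_eq_0_iff)
qed

text \<open>\<open>E0\<close> is evaluated at an arbitrarily chosen weak derivative. This lets the
  chosen one for the catenary be replaced by its explicit slope.\<close>

lemma has_ac_deriv_unique:
  assumes "a \<le> b" "has_ac_deriv f g a b" "has_ac_deriv f g' a b"
  shows "negligible {x \<in> {a..b}. g x \<noteq> g' x}"
proof -
  have "has_ac_deriv (\<lambda>x. f x + (-1) * f x) (\<lambda>x. g x + (-1) * g' x) a b"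
    by (intro has_ac_deriv_add has_ac_deriv_cmult assms)
  then have "has_ac_deriv (\<lambda>_. 0) (\<lambda>x. g x + (-1) * g' x) a b" by simp
  from has_ac_deriv_zero_negligible[OF assms(1) this] show ?thesis by simp
qed

lemma has_ac_deriv_cong:
  assumes "has_ac_deriv f g a b"
    and "\<And>x. x \<in> {a..b} \<Longrightarrow> f x = f' x" "\<And>x. x \<in> {a..b} \<Longrightarrow> g x = g' x"
  shows "has_ac_deriv f' g' a b"
proof (rule has_ac_derivI)
  show "g' absolutely_integrable_on {a..b}"
    using has_ac_deriv_abs_integrable[OF assms(1)] assms(3)
    by (metis (no_types, lifting) set_integrable_cong)
  fix x assume x: "a \<le> x" "x \<le> b"
  have "f' x - f' a = f x - f a" using assms(2) x by simp
  also have "\<dots> = integral {a..x} g" using x by (intro has_ac_deriv_increment[OF assms(1)]) auto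
  also have "\<dots> = integral {a..x} g'" using assms(3) x by (intro Henstock_Kurzweil_Integration.integral_cong) auto
  finally show "f' x - f' a = integral {a..x} g'" .
qed

lemma has_ac_deriv_reflect:
  assumes "has_ac_deriv f g (- b) (- a)"
  shows "has_ac_deriv (\<lambda>x. f (- x)) (\<lambda>x. - g (- x)) a b"
proof (rule has_ac_derivI)
  have "(\<lambda>x. g (- x)) absolutely_integrable_on {a..b}"
    using has_ac_deriv_abs_integrable[OF assms] by (subst absolutely_integrable_reflect_real[symmetric]) simp
  from set_integrable_mult_right[OF this, of "-1"]
  show "(\<lambda>x. - g (- x)) absolutely_integrable_on {a..b}" by simp
  fix x assume x: "a \<le> x" "x \<le> b"
  have "f (- a) - f (- x) = integral {- x..- a} g"
    using x by (intro has_ac_deriv_increment[OF assms]) auto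
  also have "\<dots> = integral {a..x} (\<lambda>s. g (- s))"
    using Henstock_Kurzweil_Integration.integral_reflect_real[of x a "\<lambda>s. g (- s)"]
    by (simp only: minus_minus)
  finally show "f (- x) - f (- a) = integral {a..x} (\<lambda>s. - g (- s))" by simp
qed

lemma has_ac_deriv_smooth:
  assumes "\<And>x. x \<in> {a..b} \<Longrightarrow> (f has_real_derivative f' x) (at x)" "continuous_on {a..b} f'"
  shows "has_ac_deriv f f' a b"
proof (rule has_ac_derivI)
  show "f' absolutely_integrable_on {a..b}" by (rule absolutely_integrable_continuous_real[OF assms(2)])
  fix x assume x: "a \<le> x" "x \<le> b"
  have "(f' has_integral (f x - f a)) {a..x}"
  proof (rule fundamental_theorem_of_calculus)
    show "(f has_vector_derivative f' y) (at y within {a..x})" if "y \<in> {a..x}" for y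
      unfolding has_real_derivative_iff_has_vector_derivative[symmetric]
      using assms(1)[of y] that x by (metis atLeastAtMost_iff has_field_derivative_at_within order_trans)
  qed (use x in simp)
  then show "f x - f a = integral {a..x} f'" by (rule integral_unique[symmetric])
qed

section \<open>The catenary parameter as a function of x / y\<close>

text \<open>The ratio x / y on the catenary y = P cosh (x / P), with t = x / P.\<close>

definition kappa :: "real \<Rightarrow> real" where "kappa t = t / cosh t"

text \<open>\<open>kappa\<close> increases until t tanh t = 1, at t about 1.2. The bound 1 is a
  convenient value below this that still exceeds the parameter of \<open>omega\<close>, about
  0.64.\<close>

definition tau :: "real \<Rightarrow> real" where "tau = inv_into {-1<..<1} kappa"

text \<open>The catenary over [0, x] with waist P at 0 and end height y has energy y^2 * half_area (x / P);
  the value 1/2 is that of the degenerate competitor dropping to height 0.\<close>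
definition half_area :: "real \<Rightarrow> real" where
  "half_area t = (t + sinh t * cosh t) / (2 * (cosh t)\<^sup>2)"

text \<open>For |t| at most 1 it is enough that |sinh t| < cosh t. The difference is the numerator
  of the derivative of \<open>kappa\<close> and the denominator in that of
  \<open>tau\<close>.\<close>

lemma cosh_gt_mult_sinh:
  fixes t :: real
  assumes "\<bar>t\<bar> \<le> 1"
  shows "t * sinh t < cosh t"
proof -
  have "t * sinh t \<le> \<bar>t\<bar> * \<bar>sinh t\<bar>" by (metis abs_ge_self abs_mult)
  also have "\<dots> \<le> \<bar>sinh t\<bar>" using assms by (simp add: mult_left_le_one_le)
  also have "\<dots> < cosh t"
    using sinh_less_cosh_real[of t] sinh_less_cosh_real[of "-t"] by (simp add: abs_if)
  finally show ?thesis .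
qed

lemma kappa_deriv: "(kappa has_real_derivative (cosh t - t * sinh t) / (cosh t)\<^sup>2) (at t)"
  unfolding kappa_def[abs_def] by (auto intro!: derivative_eq_intros simp: power2_eq_square)

lemma kappa_strict_mono:
  assumes "-1 \<le> s" "s < t" "t \<le> 1"
  shows "kappa s < kappa t"
proof (rule DERIV_pos_imp_increasing[OF assms(2)])
  fix x assume "s \<le> x" "x \<le> t"
  then have "\<bar>x\<bar> \<le> 1" using assms by simp
  from cosh_gt_mult_sinh[OF this] show "\<exists>y. (kappa has_real_derivative y) (at x) \<and> 0 < y"
    by (intro exI[of _ "(cosh x - x * sinh x) / (cosh x)\<^sup>2"] conjI kappa_deriv) simp
qed

lemma kappa_minus: "kappa (- t) = - kappa t"
  by (simp add: kappa_def)

lemma kappa_inj: "inj_on kappa {-1<..<1}"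
proof (rule linorder_inj_onI)
  fix x y :: real
  assume "x < y" "x \<in> {-1<..<1}" "y \<in> {-1<..<1}"
  then show "kappa x \<noteq> kappa y" using kappa_strict_mono[of x y] by simp
qed auto

lemma tau_kappa: "-1 < t \<Longrightarrow> t < 1 \<Longrightarrow> tau (kappa t) = t"
  unfolding tau_def by (rule inv_into_f_f[OF kappa_inj]) simp

lemma kappa_surj:
  assumes "- kappa 1 < u" "u < kappa 1"
  obtains t where "-1 < t" "t < 1" "kappa t = u"
proof -
  have "\<exists>t\<ge>-1. t \<le> 1 \<and> kappa t = u"
    by (rule IVT) (use assms in \<open>auto simp: kappa_minus intro!: DERIV_isCont kappa_deriv\<close>)
  then show thesis using assms that by (metis kappa_minus order_le_less order_less_irrefl)
qed

lemma tau_props: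
  assumes "u \<in> {- kappa 1<..<kappa 1}"
  shows "kappa (tau u) = u" "-1 < tau u" "tau u < 1"
proof -
  obtain t where "-1 < t" "t < 1" "kappa t = u" using kappa_surj assms by auto
  then show "kappa (tau u) = u" "-1 < tau u" "tau u < 1" using tau_kappa[of t] by auto
qed

lemma tau_cont:
  assumes "u \<in> {- kappa 1<..<kappa 1}"
  shows "isCont tau u"
proof -
  define t where "t = tau u"
  have t: "kappa t = u" "-1 < t" "t < 1" using tau_props[OF assms] by (auto simp: t_def)
  obtain d where d: "d > 0" "-1 < t - d" "t + d < 1"
  proof
    show "min (1 - t) (t + 1) / 2 > 0" "-1 < t - min (1 - t) (t + 1) / 2" "t + min (1 - t) (t + 1) / 2 < 1"
      using t by (auto simp: min_def field_simps)
  qed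
  have "isCont tau (kappa t)"
    by (rule isCont_inverse_function[OF d(1)])
      (use d in \<open>auto intro!: tau_kappa DERIV_isCont kappa_deriv simp: abs_le_iff\<close>)
  then show ?thesis using t by simp
qed

lemma tau_deriv:
  assumes u: "u \<in> {- kappa 1<..<kappa 1}"
  shows "(tau has_real_derivative (cosh (tau u))\<^sup>2 / (cosh (tau u) - tau u * sinh (tau u))) (at u)"
proof -
  have "cosh (tau u) - tau u * sinh (tau u) > 0"
    using tau_props[OF u] by (simp add: cosh_gt_mult_sinh)
  then have "(tau has_real_derivative inverse ((cosh (tau u) - tau u * sinh (tau u)) / (cosh (tau u))\<^sup>2)) (at u)"
  proof (intro DERIV_inverse_function[where f=kappa and a="- kappa 1" and b="kappa 1"] kappa_deriv tau_cont u)
    show "kappa (tau y) = y" if "- kappa 1 < y" "y < kappa 1" for y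
      using that by (intro tau_props) simp
  qed (use u in auto)
  then show ?thesis unfolding inverse_divide .
qed

lemma half_area_deriv:
  "(half_area has_real_derivative (cosh t - t * sinh t) / (cosh t)^3) (at t)"
proof -
  have "(half_area has_real_derivative ((1 + (cosh t * cosh t + sinh t * sinh t)) * (2 * (cosh t)\<^sup>2) -
      (t + sinh t * cosh t) * (2 * (2 * cosh t * sinh t))) / (2 * (cosh t)\<^sup>2)\<^sup>2) (at t)"
    unfolding half_area_def[abs_def]
    by (auto intro!: derivative_eq_intros simp: power2_eq_square algebra_simps)
  also have "((1 + (cosh t * cosh t + sinh t * sinh t)) * (2 * (cosh t)\<^sup>2) -
      (t + sinh t * cosh t) * (2 * (2 * cosh t * sinh t))) / (2 * (cosh t)\<^sup>2)\<^sup>2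
    = (cosh t - t * sinh t) / (cosh t)^3"
  proof -
    have s: "sinh t * sinh t = cosh t * cosh t - 1"
      using cosh_square_eq[of t] by (simp add: power2_eq_square)
    have "(1 + (cosh t * cosh t + sinh t * sinh t)) * (2 * (cosh t)\<^sup>2) -
      (t + sinh t * cosh t) * (2 * (2 * cosh t * sinh t)) = 4 * cosh t * (cosh t * (cosh t)\<^sup>2 - t * sinh t
        - cosh t * (sinh t * sinh t))"
      unfolding s by (simp add: power2_eq_square algebra_simps) (use s in algebra)
    also have "\<dots> = 4 * cosh t * (cosh t - t * sinh t)"
      unfolding s by (simp add: power2_eq_square algebra_simps)
    finally show ?thesis by (simp add: field_simps power2_eq_square power3_eq_cube)
  qed
  finally show ?thesis .
qed

text \<open>The factor cosh t - t sinh t cancels between \<open>half_area_deriv\<close> and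
  \<open>tau_deriv\<close>. In terms of \<open>calib\<close> this says that the x-derivative is y /
  cosh t.\<close>

lemma half_area_tau_deriv:
  assumes u: "u \<in> {- kappa 1<..<kappa 1}"
  shows "((\<lambda>u. half_area (tau u)) has_real_derivative 1 / cosh (tau u)) (at u)"
proof -
  have "cosh (tau u) - tau u * sinh (tau u) > 0"
    using tau_props[OF u] by (simp add: cosh_gt_mult_sinh)
  then show ?thesis
    using DERIV_chain2[OF half_area_deriv tau_deriv[OF u]]
    by (simp add: power2_eq_square power3_eq_cube)
qed

text \<open>The y-derivative of y^2 A(x / y) is y (2 A(u) - u A'(u)) with u = x / y. The identity
  makes it y tanh t, so the gradient of \<open>calib\<close> is y times the unit tangent (1 / cosh
  t, tanh t) of the catenary.\<close>

lemma half_area_identity: "2 * half_area t - kappa t / cosh t = tanh t"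
proof -
  have "2 * half_area t - kappa t / cosh t =
      t / (cosh t)\<^sup>2 + sinh t * cosh t / (cosh t)\<^sup>2 - t / (cosh t)\<^sup>2"
    by (simp add: half_area_def kappa_def power2_eq_square add_divide_distrib)
  then show ?thesis by (simp add: tanh_def power2_eq_square)
qed

section \<open>The threshold ratio and the largest waist\<close>

text \<open>Since cosh t - sinh t = exp (- t), the hyperbolic equation becomes one between an
  increasing and a decreasing function, which has at most one real root.\<close>

lemma half_area_eq_half_iff: "half_area t = 1 / 2 \<longleftrightarrow> 2 * t = 1 + exp (- 2 * t)"
proof -
  have "half_area t = 1 / 2 \<longleftrightarrow> t + sinh t * cosh t = (cosh t)\<^sup>2"
    by (auto simp: half_area_def divide_eq_eq)
  also have "\<dots> \<longleftrightarrow> t = cosh t * (cosh t - sinh t)"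
    unfolding power2_eq_square right_diff_distrib by argo
  also have "\<dots> \<longleftrightarrow> 2 * t = (exp t + exp (- t)) * exp (- t)"
    unfolding cosh_minus_sinh by (simp add: cosh_def mult.commute)
  also have "(exp t + exp (- t)) * exp (- t) = 1 + exp (- 2 * t)"
    unfolding distrib_right exp_add[symmetric] by simp
  finally show ?thesis .
qed

text \<open>With t = 1 / \<xi>, the left side of the equation defining \<open>Xi\<close> is \<xi> *
  2 * \<open>half_area\<close> t, so the equation reads \<open>half_area\<close> t = 1/2. Its root
  is found on [0, 1] in the exponential form, and its uniqueness is what evaluates the
  \<open>THE\<close>.\<close>

lemma omega_eq:
  obtains t where "0 < t" "t < 1" "omega = kappa t" "half_area t = 1 / 2"
proof -
  have "\<exists>t\<ge>0. t \<le> 1 \<and> 2 * t - exp (- 2 * t) = (1::real)"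
  proof (rule IVT)
    show "(1::real) \<le> 2 * 1 - exp (- 2 * 1)" by simp
    show "\<forall>x. 0 \<le> x \<and> x \<le> (1::real) \<longrightarrow> isCont (\<lambda>t. 2 * t - exp (- 2 * t)) x"
      by (intro allI impI continuous_intros)
  qed auto
  then obtain t :: real where t: "0 \<le> t" "t \<le> 1" "2 * t - exp (- 2 * t) = 1" by blast
  have e1: "t > 0" using t(3) exp_gt_zero[of "- 2 * t"] by argo
  have e2: "exp (- 2 * t) < 1" using e1 by simp
  have t1: "t < 1" using t(3) e2 by argo
  have half: "half_area t = 1 / 2" using t(3) unfolding half_area_eq_half_iff by linarith
  have uniq: "s = t" if "half_area s = 1 / 2" for s
  proof (rule ccontr)
    assume "s \<noteq> t"
    have eq: "2 * s = 1 + exp (- 2 * s)" using that half_area_eq_half_iff by blast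
    consider "s < t" | "t < s" using \<open>s \<noteq> t\<close> by linarith
    then show False
    proof cases
      case 1
      then have "exp (- 2 * s) > exp (- 2 * t)" by simp
      with 1 eq t(3) show False by linarith
    next
      case 2
      then have "exp (- 2 * s) < exp (- 2 * t)" by simp
      with 2 eq t(3) show False by linarith
    qed
  qed
  have Xi_eq: "\<xi> * tanh (1/\<xi>) + (sech (1/\<xi>))\<^sup>2 = \<xi> \<longleftrightarrow> half_area (1 / \<xi>) = 1 / 2" if "\<xi> > 0" for \<xi>
  proof -
    have "\<xi> * tanh (1/\<xi>) + (sech (1/\<xi>))\<^sup>2 = \<xi> * (2 * half_area (1 / \<xi>))"
    proof -
      have c: "cosh (1/\<xi>) \<noteq> 0" by simp
      have "\<xi> * (2 * half_area (1 / \<xi>)) = (\<xi> * (1 / \<xi>) + \<xi> * (sinh (1/\<xi>) * cosh (1/\<xi>))) / (cosh (1/\<xi>))\<^sup>2"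
        unfolding half_area_def using c by (simp add: divide_simps)
      also have "\<dots> = 1 / (cosh (1/\<xi>))\<^sup>2 + \<xi> * (sinh (1/\<xi>) / cosh (1/\<xi>))"
        using that by (simp add: add_divide_distrib power2_eq_square)
      finally show ?thesis by (simp add: sech_def tanh_def power_divide)
    qed
    also have "\<dots> = \<xi> \<longleftrightarrow> 2 * half_area (1 / \<xi>) = 1" using that by simp
    finally show ?thesis by linarith
  qed
  have Xi: "Xi = 1 / t"
    unfolding Xi_def
  proof (rule the_equality)
    show "1 / t > 0 \<and> 1 / t * tanh (1 / (1 / t)) + (sech (1 / (1 / t)))\<^sup>2 = 1 / t"
      using Xi_eq[of "1 / t"] e1 half by simp
    show "\<xi> = 1 / t" if "\<xi> > 0 \<and> \<xi> * tanh (1/\<xi>) + (sech (1/\<xi>))\<^sup>2 = \<xi>" for \<xi>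
      using Xi_eq[of \<xi>] uniq[of "1 / \<xi>"] that by auto
  qed
  have "omega = kappa t" unfolding omega_def kappa_def Xi by simp
  with e1 t1 half that show thesis by blast
qed

lemma omega_props: "0 < omega" "omega < kappa 1" "half_area (tau omega) = 1 / 2"
proof -
  obtain t where t: "0 < t" "t < 1" "omega = kappa t" "half_area t = 1 / 2" by (rule omega_eq)
  show "0 < omega" using t(1) unfolding t(3) kappa_def by simp
  show "omega < kappa 1" unfolding t(3) using t by (intro kappa_strict_mono) auto
  show "half_area (tau omega) = 1 / 2" using t(1,2,4) unfolding t(3) by (simp add: tau_kappa)
qed

lemma tau_pos:
  assumes "0 < u" "u < kappa 1"
  shows "0 < tau u"
proof -
  have "kappa (tau u) = u" using assms by (intro tau_props) auto
  then have "tau u / cosh (tau u) > 0" using assms unfolding kappa_def by simp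
  then show ?thesis using cosh_real_pos[of "tau u"] by (auto simp: zero_less_divide_iff simp del: cosh_real_pos)
qed

text \<open>The largest waist p corresponds to the smallest positive parameter h / p. Since
  \<open>kappa\<close> increases strictly on [0, 1], no positive root of kappa s = h / r lies below
  the one that \<open>tau\<close> selects.\<close>

lemma Pi0_eq:
  assumes "h > 0" "r > 0" "h / r < kappa 1"
  shows "Pi0 h r = h / tau (h / r)"
proof -
  define t where "t = tau (h / r)"
  have u: "0 < h / r" "h / r \<in> {- kappa 1<..<kappa 1}" 
  proof -
    show pos: "0 < h / r" using assms by simp
    show "h / r \<in> {- kappa 1<..<kappa 1}" using pos assms(3) unfolding greaterThanLessThan_iff by (metis add_0 add_less_cancel_right less_trans neg_less_0_iff_less)
  qed
  have t: "0 < t" "t < 1" "t / cosh t = h / r"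
    using tau_pos[of "h / r"] tau_props[OF u(2)] u assms by (auto simp: t_def kappa_def)
  show ?thesis unfolding Pi0_def t_def[symmetric]
  proof (rule Greatest_equality)
    show "h / t > 0 \<and> r = h / t * cosh (h / (h / t))" using assms t(1,3) by (simp add: divide_simps mult.commute)
    fix p assume p: "p > 0 \<and> r = p * cosh (h / p)"
    have "kappa (h / p) = h / r"
      using p assms(2) unfolding kappa_def by (metis divide_divide_eq_left)
    then have eq: "kappa (h / p) = kappa t" using t(3) unfolding kappa_def by simp
    have "0 < h / p" using p assms by simp
    then have "\<not> h / p < t" using kappa_strict_mono[of "h / p" t] eq t(2) by linarith
    then have "t \<le> h / p" by simp
    then show "p \<le> h / t" using p t by (simp add: pos_le_divide_eq mult.commute)
  qed
qed

section \<open>Calibration\<close>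

definition energy :: "real \<Rightarrow> real \<Rightarrow> (real \<Rightarrow> real) \<Rightarrow> (real \<Rightarrow> real) \<Rightarrow> real" where
  "energy a b f g = integral {a..b} (\<lambda>x. f x * sqrt (1 + (g x)\<^sup>2))"

lemma energy_density_abs_integrable:
  fixes f g :: "real \<Rightarrow> real"
  assumes f: "continuous_on {a..b} f" and g: "g absolutely_integrable_on {a..b}"
  shows "(\<lambda>x. f x * sqrt (1 + (g x)\<^sup>2)) absolutely_integrable_on {a..b}"
proof (rule abs_integrable_mult_continuous[OF f])
  have gm: "g \<in> borel_measurable (lebesgue_on {a..b})"
    using g by (rule absolutely_integrable_measurable[THEN iffD1, THEN conjunct1, rotated]) simp
  show "(\<lambda>x. sqrt (1 + (g x)\<^sup>2)) absolutely_integrable_on {a..b}"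
  proof (rule measurable_bounded_by_integrable_imp_absolutely_integrable)
    show "(\<lambda>x. sqrt (1 + (g x)\<^sup>2)) \<in> borel_measurable (lebesgue_on {a..b})"
      using gm by measurable
    show "(\<lambda>x. 1 + \<bar>g x\<bar>) integrable_on {a..b}"
      using g by (intro Henstock_Kurzweil_Integration.integrable_add)
        (auto simp: absolutely_integrable_on_def)
    show "norm (sqrt (1 + (g x)\<^sup>2)) \<le> 1 + \<bar>g x\<bar>" for x
      using sqrt_add_le_add_sqrt[of 1 "(g x)\<^sup>2"] by simp
  qed simp
qed

lemma energy_density_integrable:
  assumes "has_ac_deriv f g a b"
  shows "(\<lambda>x. f x * sqrt (1 + (g x)\<^sup>2)) integrable_on {a..b}"
  using energy_density_abs_integrable[OF has_ac_deriv_continuous[OF assms] has_ac_deriv_abs_integrable[OF assms]]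
  by (simp add: absolutely_integrable_on_def)

lemma energy_split:
  assumes "has_ac_deriv f g a b" "a \<le> c" "c \<le> b"
  shows "energy a b f g = energy a c f g + energy c b f g"
  unfolding energy_def
  by (rule Henstock_Kurzweil_Integration.integral_combine[symmetric, OF assms(2,3) energy_density_integrable[OF assms(1)]])

lemma energy_cong_negligible:
  assumes "negligible {x \<in> {a..b}. g x \<noteq> g' x}"
  shows "energy a b f g = energy a b f g'"
  unfolding energy_def
  by (rule integral_spike[OF assms]) auto

text \<open>Both \<open>calib\<close> and the waist are a power of f times a function of x / f x, so
  this one chain rule serves both.\<close>

lemma has_ac_deriv_ratio:
  assumes f: "has_ac_deriv f g a b" and pos: "\<And>x. x \<in> {a..b} \<Longrightarrow> f x > 0"
    and J: "\<And>x. x \<in> {a..b} \<Longrightarrow> x / f x \<in> {- kappa 1<..<kappa 1}"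
    and p: "\<And>u. u \<in> {- kappa 1<..<kappa 1} \<Longrightarrow> (p has_real_derivative p' u) (at u)"
    and p': "continuous_on {- kappa 1<..<kappa 1} p'"
  shows "has_ac_deriv (\<lambda>x. p (x / f x)) (\<lambda>x. p' (x / f x) * ((1 - x / f x * g x) / f x)) a b"
proof -
  have inv: "has_ac_deriv (\<lambda>x. inverse (f x)) (\<lambda>x. - (inverse (f x) * inverse (f x)) * g x) a b"
  proof (rule has_ac_deriv_compose[OF f, where S="{0<..}"])
    show "(inverse has_real_derivative - (inverse y * inverse y)) (at y)" if "y \<in> {0<..}" for y :: real
      using that by (auto intro!: derivative_eq_intros)
    show "continuous_on {0<..} (\<lambda>y::real. - (inverse y * inverse y))"
      by (intro continuous_intros) auto
    show "is_interval {0::real<..}" by simp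
    show "f ` {a..b} \<subseteq> {0<..}" using pos by auto
  qed
  have "has_ac_deriv (\<lambda>x. x * inverse (f x))
      (\<lambda>x. 1 * inverse (f x) + x * (- (inverse (f x) * inverse (f x)) * g x)) a b"
    by (intro has_ac_deriv_mult inv has_ac_deriv_smooth) (auto intro!: derivative_eq_intros)
  then have "has_ac_deriv (\<lambda>x. x / f x) (\<lambda>x. (1 - x / f x * g x) / f x) a b"
    by (rule has_ac_deriv_cong) (auto simp: divide_inverse algebra_simps)
  then show ?thesis
  proof (rule has_ac_deriv_compose[where S="{- kappa 1<..<kappa 1}"])
    show "(\<lambda>x. x / f x) ` {a..b} \<subseteq> {- kappa 1<..<kappa 1}" using J by blast
  qed (use p p' in auto)
qed

lemma tau_continuous_on: "continuous_on {- kappa 1<..<kappa 1} tau"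
  by (intro continuous_at_imp_continuous_on ballI tau_cont)

text \<open>The energy of the catenary arc joining the axis x = 0 to the point (x, y).\<close>
definition calib :: "real \<Rightarrow> real \<Rightarrow> real" where
  "calib x y = y\<^sup>2 * half_area (tau (x / y))"

lemma calib_has_ac_deriv:
  assumes f: "has_ac_deriv f g a b" and pos: "\<And>x. x \<in> {a..b} \<Longrightarrow> f x > 0"
    and J: "\<And>x. x \<in> {a..b} \<Longrightarrow> x / f x \<in> {- kappa 1<..<kappa 1}"
  shows "has_ac_deriv (\<lambda>x. calib x (f x))
    (\<lambda>x. f x * (g x * tanh (tau (x / f x)) + 1 / cosh (tau (x / f x)))) a b"
proof -
  have F: "has_ac_deriv (\<lambda>x. half_area (tau (x / f x)))
      (\<lambda>x. 1 / cosh (tau (x / f x)) * ((1 - x / f x * g x) / f x)) a b"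
    by (rule has_ac_deriv_ratio[OF f pos J half_area_tau_deriv])
      (auto intro!: continuous_intros tau_continuous_on)
  have "has_ac_deriv (\<lambda>x. (f x * f x) * half_area (tau (x / f x)))
      (\<lambda>x. (g x * f x + f x * g x) * half_area (tau (x / f x)) +
        (f x * f x) * (1 / cosh (tau (x / f x)) * ((1 - x / f x * g x) / f x))) a b"
    by (intro has_ac_deriv_mult f F)
  then show ?thesis
  proof (rule has_ac_deriv_cong)
    fix x assume x: "x \<in> {a..b}"
    define u t where "u = x / f x" and "t = tau u"
    have t: "kappa t = u" using tau_props(1)[OF J[OF x]] by (simp add: t_def u_def)
    have fx: "f x \<noteq> 0" using pos[OF x] by simp
    have "tanh t = 2 * half_area t - u / cosh t" using half_area_identity[of t] t by simp
    then have "f x * (g x * tanh t + 1 / cosh t) =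
        f x * (g x * (2 * half_area t - u / cosh t) + 1 / cosh t)" by simp
    also have "\<dots> = (g x * f x + f x * g x) * half_area t + f x * (1 / cosh t * (1 - u * g x))"
      by (simp add: algebra_simps diff_divide_distrib)
    also have "f x * (1 / cosh t * (1 - u * g x)) = (f x * f x) * (1 / cosh t * ((1 - u * g x) / f x))"
      using fx by simp
    finally show "(g x * f x + f x * g x) * half_area (tau (x / f x)) +
        (f x * f x) * (1 / cosh (tau (x / f x)) * ((1 - x / f x * g x) / f x)) =
        f x * (g x * tanh (tau (x / f x)) + 1 / cosh (tau (x / f x)))"
      unfolding t_def u_def by simp
  qed (auto simp: calib_def power2_eq_square)
qed

text \<open>Cauchy-Schwarz for (1, g) and the unit vector (1 / cosh t, tanh t).\<close>
lemma calib_bound: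
  fixes g t :: real
  shows "g * tanh t + 1 / cosh t \<le> sqrt (1 + g\<^sup>2)"
    and "g * tanh t + 1 / cosh t = sqrt (1 + g\<^sup>2) \<Longrightarrow> g = sinh t"
proof -
  have c: "cosh t > 0" by simp
  have s: "(sinh t)\<^sup>2 = (cosh t)\<^sup>2 - 1" using cosh_square_eq[of t] by simp
  have "(g * sinh t + 1)\<^sup>2 + (g - sinh t)\<^sup>2 = (1 + g\<^sup>2) * (1 + (sinh t)\<^sup>2)"
    by (simp add: power2_eq_square algebra_simps)
  also have "\<dots> = (1 + g\<^sup>2) * (cosh t)\<^sup>2" by (simp add: s)
  finally have "((g * sinh t + 1)\<^sup>2 + (g - sinh t)\<^sup>2) / (cosh t)\<^sup>2 = 1 + g\<^sup>2"
    using c by simp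
  moreover have eq: "g * tanh t + 1 / cosh t = (g * sinh t + 1) / cosh t"
    by (simp add: tanh_def add_divide_distrib)
  have "(g * tanh t + 1 / cosh t)\<^sup>2 + ((g - sinh t) / cosh t)\<^sup>2 =
      ((g * sinh t + 1)\<^sup>2 + (g - sinh t)\<^sup>2) / (cosh t)\<^sup>2"
    unfolding eq power_divide by (rule add_divide_distrib[symmetric])
  ultimately have *: "(g * tanh t + 1 / cosh t)\<^sup>2 + ((g - sinh t) / cosh t)\<^sup>2 = 1 + g\<^sup>2"
    by simp
  show "g * tanh t + 1 / cosh t \<le> sqrt (1 + g\<^sup>2)"
    by (rule real_le_rsqrt) (use * zero_le_power2[of "(g - sinh t) / cosh t"] in linarith)
  assume "g * tanh t + 1 / cosh t = sqrt (1 + g\<^sup>2)"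
  then have "(g * tanh t + 1 / cosh t)\<^sup>2 = 1 + g\<^sup>2" by (simp add: add_nonneg_nonneg)
  with * have "((g - sinh t) / cosh t)\<^sup>2 = 0" by linarith
  then show "g = sinh t" using c by simp
qed

section \<open>Lower bounds for the energy by potentials\<close>

text \<open>The comparison shared by the potentials \<open>calib\<close> and y^2 / 2. In the
  equality case a nonnegative integrand has integral 0.\<close>

lemma energy_ge_has_ac_deriv:
  assumes "a \<le> b" and f: "has_ac_deriv f g a b" and F: "has_ac_deriv F k a b"
    and le: "\<And>x. x \<in> {a..b} \<Longrightarrow> k x \<le> f x * sqrt (1 + (g x)\<^sup>2)"
  shows "F b - F a \<le> energy a b f g"
    and "energy a b f g = F b - F a \<Longrightarrow> negligible {x \<in> {a..b}. k x \<noteq> f x * sqrt (1 + (g x)\<^sup>2)}"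
proof -
  have k: "k integrable_on {a..b}"
    using has_ac_deriv_abs_integrable[OF F] by (simp add: absolutely_integrable_on_def)
  note e = energy_density_integrable[OF f]
  have F: "F b - F a = integral {a..b} k"
    using assms(1) by (intro has_ac_deriv_increment[OF F]) auto
  show "F b - F a \<le> energy a b f g"
    unfolding F energy_def by (rule integral_le[OF k e le])
  assume "energy a b f g = F b - F a"
  then have "integral {a..b} (\<lambda>x. f x * sqrt (1 + (g x)\<^sup>2) - k x) = 0"
    by (simp add: F energy_def Henstock_Kurzweil_Integration.integral_diff[OF e k])
  then have "negligible {x \<in> {a..b}. f x * sqrt (1 + (g x)\<^sup>2) - k x \<noteq> 0}"
    using le by (intro nonneg_integral_zero_imp_negligible Henstock_Kurzweil_Integration.integrable_diff e k) auto
  then show "negligible {x \<in> {a..b}. k x \<noteq> f x * sqrt (1 + (g x)\<^sup>2)}"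
    by (rule negligible_subset) auto
qed

lemma energy_gt_half_square:
  assumes "a < b" and f: "has_ac_deriv f g a b" and pos: "\<And>x. x \<in> {a..b} \<Longrightarrow> f x > 0"
  shows "(f b)\<^sup>2 / 2 - (f a)\<^sup>2 / 2 < energy a b f g"
proof -
  have sq: "has_ac_deriv (\<lambda>x. (f x)\<^sup>2 / 2) (\<lambda>x. f x * g x) a b"
    by (rule has_ac_deriv_compose[OF f, where S=UNIV])
      (auto intro!: derivative_eq_intros continuous_intros)
  have lt: "f x * g x < f x * sqrt (1 + (g x)\<^sup>2)" if "x \<in> {a..b}" for x
  proof -
    have "g x \<le> sqrt ((g x)\<^sup>2)" by simp
    also have "\<dots> < sqrt (1 + (g x)\<^sup>2)" by (simp only: real_sqrt_less_iff)
    finally show ?thesis using pos[OF that] by simp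
  qed
  have "energy a b f g \<noteq> (f b)\<^sup>2 / 2 - (f a)\<^sup>2 / 2"
  proof
    assume eq: "energy a b f g = (f b)\<^sup>2 / 2 - (f a)\<^sup>2 / 2"
    have "negligible {x \<in> {a..b}. f x * g x \<noteq> f x * sqrt (1 + (g x)\<^sup>2)}"
      using assms(1) lt by (intro energy_ge_has_ac_deriv(2)[OF _ f sq _ eq]) (auto intro: less_imp_le)
    \<comment> \<open>Since sqrt (1 + g^2) > g at every point, equality would make the whole
      interval negligible.\<close>
    moreover have "{x \<in> {a..b}. f x * g x \<noteq> f x * sqrt (1 + (g x)\<^sup>2)} = {a..b}"
      using lt less_imp_neq by blast
    ultimately have "negligible (cbox a b)" by simp
    then have "box a b = {}" using negligible_interval(1) by blast
    then show False using assms(1) by simp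
  qed
  moreover have "(f b)\<^sup>2 / 2 - (f a)\<^sup>2 / 2 \<le> energy a b f g"
    using assms(1) lt by (intro energy_ge_has_ac_deriv(1)[OF _ f sq]) (auto intro: less_imp_le)
  ultimately show ?thesis by simp
qed

text \<open>The waist of the catenary through (x, f x) is a first integral of the extremal field g = sinh t.\<close>
lemma catenary_waist_has_ac_deriv:
  assumes f: "has_ac_deriv f g a b" and pos: "\<And>x. x \<in> {a..b} \<Longrightarrow> f x > 0"
    and J: "\<And>x. x \<in> {a..b} \<Longrightarrow> x / f x \<in> {- kappa 1<..<kappa 1}"
  obtains w where "has_ac_deriv (\<lambda>x. f x / cosh (tau (x / f x))) w a b"
    "\<And>x. x \<in> {a..b} \<Longrightarrow> g x = sinh (tau (x / f x)) \<Longrightarrow> w x = 0"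
proof
  define q' where "q' u = - sinh (tau u) / (cosh (tau u) - tau u * sinh (tau u))" for u
  have nz: "cosh (tau u) - tau u * sinh (tau u) \<noteq> 0" if "u \<in> {- kappa 1<..<kappa 1}" for u
    using cosh_gt_mult_sinh[of "tau u"] tau_props[OF that] by (simp add: abs_le_iff)
  have q': "((\<lambda>u. 1 / cosh (tau u)) has_real_derivative q' u) (at u)" if "u \<in> {- kappa 1<..<kappa 1}" for u
    using nz[OF that] unfolding q'_def
    by (auto intro!: derivative_eq_intros tau_deriv[OF that] simp: power2_eq_square)
  have "has_ac_deriv (\<lambda>x. 1 / cosh (tau (x / f x))) (\<lambda>x. q' (x / f x) * ((1 - x / f x * g x) / f x)) a b"
  proof (rule has_ac_deriv_ratio[OF f pos J q'])
    show "continuous_on {- kappa 1<..<kappa 1} q'"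
      unfolding q'_def using nz by (intro continuous_intros tau_continuous_on) auto
  qed
  from has_ac_deriv_mult[OF f this]
  show "has_ac_deriv (\<lambda>x. f x / cosh (tau (x / f x)))
    (\<lambda>x. g x * (1 / cosh (tau (x / f x))) + f x * (q' (x / f x) * ((1 - x / f x * g x) / f x))) a b"
    by simp
  fix x assume x: "x \<in> {a..b}" and g: "g x = sinh (tau (x / f x))"
  define t where "t = tau (x / f x)"
  have t: "x / f x = t / cosh t" using tau_props(1)[OF J[OF x]] by (simp add: kappa_def t_def)
  have d: "cosh t - t * sinh t \<noteq> 0" using nz[OF J[OF x]] by (simp add: t_def)
  \<comment> \<open>On the field, 1 - u g is a multiple of the denominator of q', and the two terms
    of the product rule cancel.\<close>
  have "1 - t / cosh t * sinh t = (cosh t - t * sinh t) / cosh t" by (simp add: diff_divide_distrib)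
  then have "sinh t * (1 / cosh t) + - sinh t / (cosh t - t * sinh t) * (1 - t / cosh t * sinh t) = 0"
    using d by simp
  moreover have "f x \<noteq> 0" using pos[OF x] by simp
  ultimately show "g x * (1 / cosh (tau (x / f x))) + f x * (q' (x / f x) * ((1 - x / f x * g x) / f x)) = 0"
    unfolding g q'_def t_def[symmetric] unfolding t by simp
qed

lemma energy_cone:
  assumes "a \<le> b" and f: "has_ac_deriv f g a b" and pos: "\<And>x. x \<in> {a..b} \<Longrightarrow> f x > 0"
    and J: "\<And>x. x \<in> {a..b} \<Longrightarrow> x / f x \<in> {- kappa 1<..<kappa 1}"
  shows "calib b (f b) - calib a (f a) \<le> energy a b f g"
    and "energy a b f g = calib b (f b) - calib a (f a) \<Longrightarrow> x \<in> {a..b} \<Longrightarrow>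
      f x / cosh (tau (x / f x)) = f b / cosh (tau (b / f b))"
proof -
  note c = calib_has_ac_deriv[OF f pos J]
  have le: "f x * (g x * tanh (tau (x / f x)) + 1 / cosh (tau (x / f x))) \<le> f x * sqrt (1 + (g x)\<^sup>2)"
    if "x \<in> {a..b}" for x
    using pos[OF that] by (intro mult_left_mono calib_bound(1)) auto
  show "calib b (f b) - calib a (f a) \<le> energy a b f g"
    by (rule energy_ge_has_ac_deriv(1)[OF assms(1) f c le])
  assume eq: "energy a b f g = calib b (f b) - calib a (f a)" and x: "x \<in> {a..b}"
  have neg: "negligible {x \<in> {a..b}. f x * (g x * tanh (tau (x / f x)) + 1 / cosh (tau (x / f x)))
      \<noteq> f x * sqrt (1 + (g x)\<^sup>2)}"
    by (rule energy_ge_has_ac_deriv(2)[OF assms(1) f c le eq])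
  obtain w where w: "has_ac_deriv (\<lambda>x. f x / cosh (tau (x / f x))) w a b"
    "\<And>x. x \<in> {a..b} \<Longrightarrow> g x = sinh (tau (x / f x)) \<Longrightarrow> w x = 0"
    using catenary_waist_has_ac_deriv[OF f pos J] by metis
  have w0: "w y = 0" if "y \<in> {a..b}"
    "f y * (g y * tanh (tau (y / f y)) + 1 / cosh (tau (y / f y))) = f y * sqrt (1 + (g y)\<^sup>2)" for y
    using that(2) pos[OF that(1)] by (intro w(2)[OF that(1)] calib_bound(2)) simp
  have "f b / cosh (tau (b / f b)) - f x / cosh (tau (x / f x)) = integral {x..b} w"
    using x by (intro has_ac_deriv_increment[OF w(1)]) auto
  \<comment> \<open>Off the null set where the calibration bound is strict, the slope is that of the
    field and \<open>w\<close> vanishes; so the waist has no increment.\<close>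
  also have "\<dots> = integral {x..b} (\<lambda>_. 0)"
    by (rule integral_spike[OF neg]) (use x w0 in force)
  finally show "f x / cosh (tau (x / f x)) = f b / cosh (tau (b / f b))" by simp
qed

section \<open>Competitors that leave the cone\<close>

text \<open>Take the least point of the compact set where d is nonnegative: the intermediate value
  theorem gives a zero no later than it, and minimality identifies the two.\<close>

lemma first_zero:
  fixes d :: "real \<Rightarrow> real"
  assumes "a \<le> b" and d: "continuous_on {a..b} d" and "d a \<le> 0" "d b \<ge> 0"
  obtains c where "c \<in> {a..b}" "d c = 0" "\<And>x. a \<le> x \<Longrightarrow> x \<le> c \<Longrightarrow> d x \<le> 0"
proof -
  define A where "A = {x \<in> {a..b}. d x \<ge> 0}"
  have A: "A = {a..b} \<inter> d -` {0..}" by (auto simp: A_def)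
  have "closed A" unfolding A by (rule continuous_closed_preimage[OF d]) auto
  moreover have "bounded A" unfolding A by (rule bounded_Int) simp
  ultimately have "compact A" by (simp add: compact_eq_bounded_closed)
  moreover have "A \<noteq> {}" using assms by (auto simp: A_def)
  ultimately obtain c where c: "c \<in> A" "\<And>x. x \<in> A \<Longrightarrow> c \<le> x"
    using compact_attains_inf by metis
  have "\<exists>y\<ge>a. y \<le> c \<and> d y = 0"
    using c(1) assms(3) by (intro IVT' continuous_on_subset[OF d]) (auto simp: A_def)
  then obtain y where y: "a \<le> y" "y \<le> c" "d y = 0" by blast
  from y have "y \<in> A" using c(1) by (auto simp: A_def)
  then have "c = y" using c(2) y(2) by (metis order_antisym)
  then have "d c = 0" using y by simp
  show thesis
  proof (rule that)
    show "c \<in> {a..b}" using c(1) by (auto simp: A_def)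
    fix x assume x: "a \<le> x" "x \<le> c"
    show "d x \<le> 0"
    proof (rule ccontr)
      assume n: "\<not> d x \<le> 0"
      then have "x \<in> A" using x c(1) by (auto simp: A_def)
      then have "c = x" using c(2) x(2) by (metis order_antisym)
      then show False using n \<open>d c = 0\<close> by simp
    qed
  qed fact
qed

lemma last_zero:
  fixes d :: "real \<Rightarrow> real"
  assumes "a \<le> b" and d: "continuous_on {a..b} d" and "d a \<ge> 0" "d b \<le> 0"
  obtains c where "c \<in> {a..b}" "d c = 0" "\<And>x. c \<le> x \<Longrightarrow> x \<le> b \<Longrightarrow> d x \<le> 0"
proof -
  have "continuous_on {- b..- a} (\<lambda>x. d (- x))"
    by (rule continuous_on_compose2[OF d]) (auto intro: continuous_intros)
  then obtain c where c: "c \<in> {- b..- a}" "d (- c) = 0" "\<And>x. - b \<le> x \<Longrightarrow> x \<le> c \<Longrightarrow> d (- x) \<le> 0"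
    using assms first_zero[of "- b" "- a" "\<lambda>x. d (- x)"] by auto
  show thesis
  proof (rule that[of "- c"])
    show "d x \<le> 0" if "- c \<le> x" "x \<le> b" for x using c(3)[of "- x"] that by simp
  qed (use c in auto)
qed

text \<open>The value holds for every height, so a competitor's height at x = 0 is left free. This
  is what allows the two halves of [-h, h] to be minimized independently.\<close>

lemma calib_zero: "calib 0 y = 0"
  using tau_kappa[of 0] by (simp add: calib_def kappa_def half_area_def)

lemma cone_interval:
  assumes "0 \<le> x" "y > 0" "x \<le> omega * y"
  shows "x / y \<in> {- kappa 1<..<kappa 1}"
proof -
  have "x / y \<le> omega" "0 \<le> x / y" using assms by (auto simp: pos_divide_le_eq)
  moreover have "- kappa 1 < 0" using omega_props(1,2) by linarith
  ultimately show ?thesis using omega_props(2) unfolding greaterThanLessThan_iff by linarith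
qed

lemma calib_boundary:
  assumes "y > 0" "x = omega * y"
  shows "calib x y = y\<^sup>2 / 2"
  using assms omega_props(3) by (simp add: calib_def)

lemma energy_leaving_cone:
  assumes f: "has_ac_deriv f g 0 h" and pos: "\<And>x. x \<in> {0..h} \<Longrightarrow> f x > 0"
    and hcone: "h \<le> omega * f h" and x0: "x0 \<in> {0..h}" "omega * f x0 < x0"
  shows "calib h (f h) < energy 0 h f g"
proof -
  define d where "d x = x - omega * f x" for x
  have dc: "continuous_on {0..h} d"
    unfolding d_def by (intro continuous_intros has_ac_deriv_continuous[OF f])
  have x0': "0 \<le> x0" "x0 \<le> h" using x0(1) by auto
  have d0: "d 0 \<le> 0" using pos[of 0] omega_props(1) x0' by (simp add: d_def)
  have dx0: "d x0 > 0" using x0(2) by (simp add: d_def)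
  have dh: "d h \<le> 0" using hcone by (simp add: d_def)
  obtain x1 where x1: "x1 \<in> {0..x0}" "d x1 = 0" "\<And>x. 0 \<le> x \<Longrightarrow> x \<le> x1 \<Longrightarrow> d x \<le> 0"
    using first_zero[of 0 x0 d] x0' d0 dx0 continuous_on_subset[OF dc, of "{0..x0}"]
    by (metis atLeastatMost_subset_iff less_imp_le order_refl)
  obtain x2 where x2: "x2 \<in> {x0..h}" "d x2 = 0" "\<And>x. x2 \<le> x \<Longrightarrow> x \<le> h \<Longrightarrow> d x \<le> 0"
    using last_zero[of x0 h d] x0' dh dx0 continuous_on_subset[OF dc, of "{x0..h}"]
    by (metis atLeastatMost_subset_iff less_imp_le order_refl)
  \<comment> \<open>The point x0 outside the cone separates the two crossings, so the middle
    interval has positive length and its bound is strict.\<close>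
  have "x1 \<noteq> x0" using x1(2) dx0 by auto
  then have ord: "0 \<le> x1" "x1 < x2" "x2 \<le> h" using x1(1) x2(1) by auto
  have cone: "x / f x \<in> {- kappa 1<..<kappa 1}" if "0 \<le> x" "x \<le> h" "d x \<le> 0" for x
    using that pos[of x] by (intro cone_interval) (auto simp: d_def)
  have "energy 0 h f g = energy 0 x1 f g + energy x1 h f g"
    using ord by (intro energy_split[OF f]) auto
  also have "energy x1 h f g = energy x1 x2 f g + energy x2 h f g"
    using ord by (intro energy_split has_ac_deriv_subinterval[OF f]) auto
  finally have split: "energy 0 h f g = energy 0 x1 f g + (energy x1 x2 f g + energy x2 h f g)" .
  \<comment> \<open>Both potentials agree at the crossings, so the three lower bounds telescope to
    calib h (f h).\<close>
  have b: "calib x1 (f x1) = (f x1)\<^sup>2 / 2" "calib x2 (f x2) = (f x2)\<^sup>2 / 2"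
    using ord x1(2) x2(2) pos[of x1] pos[of x2] by (intro calib_boundary; simp add: d_def)+
  have "calib x1 (f x1) - calib 0 (f 0) \<le> energy 0 x1 f g"
    using ord x1(3) pos cone by (intro energy_cone(1) has_ac_deriv_subinterval[OF f]) auto
  moreover have "(f x2)\<^sup>2 / 2 - (f x1)\<^sup>2 / 2 < energy x1 x2 f g"
    using ord pos by (intro energy_gt_half_square has_ac_deriv_subinterval[OF f]) auto
  moreover have "calib h (f h) - calib x2 (f x2) \<le> energy x2 h f g"
    using ord x2(3) pos cone by (intro energy_cone(1) has_ac_deriv_subinterval[OF f]) auto
  ultimately show ?thesis using split b calib_zero[of "f 0"] by linarith
qed

text \<open>Leaving the cone is strictly more expensive, so under equality the graph stays inside
  it; the waist is then constant, and its value at the right end is \<open>Pi0\<close>.\<close>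

lemma half_energy:
  assumes h: "0 < h" "h / r \<le> omega" and f: "has_ac_deriv f g 0 h"
    and pos: "\<And>x. x \<in> {0..h} \<Longrightarrow> f x > 0" and r: "f h = r"
  shows "calib h r \<le> energy 0 h f g"
    and "energy 0 h f g = calib h r \<Longrightarrow> x \<in> {0..h} \<Longrightarrow> f x = rho0 h r x"
proof -
  have rpos: "r > 0" using pos[of h] r h(1) by simp
  have hr: "h \<le> omega * f h" using h(2) rpos r by (simp add: pos_divide_le_eq)
  have J: "x / f x \<in> {- kappa 1<..<kappa 1}" if "\<not> (\<exists>x\<in>{0..h}. omega * f x < x)" "x \<in> {0..h}" for x
    using that pos[of x] by (intro cone_interval) (auto simp: not_less)
  note leave = energy_leaving_cone[OF f pos hr, unfolded r]
  show "calib h r \<le> energy 0 h f g"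
  proof (cases "\<exists>x\<in>{0..h}. omega * f x < x")
    case True
    then show ?thesis using leave by force
  next
    case False
    show ?thesis
      using energy_cone(1)[OF _ f pos J[OF False]] h(1) r calib_zero by simp
  qed
  assume eq: "energy 0 h f g = calib h r" and x: "x \<in> {0..h}"
  have in_cone: "\<not> (\<exists>x\<in>{0..h}. omega * f x < x)" using leave eq by force
  define t where "t = tau (x / f x)"
  define P where "P = Pi0 h r"
  have hr': "h / r \<in> {- kappa 1<..<kappa 1}" using J[OF in_cone, of h] h(1) r by simp
  have T: "0 < tau (h / r)" "h / r = tau (h / r) / cosh (tau (h / r))"
    using tau_pos[of "h / r"] tau_props(1)[OF hr'] hr' h(1) rpos by (auto simp: kappa_def)
  \<comment> \<open>This rewrites \<open>Pi0\<close> as the waist at the right end point (h, r), the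
    form in which \<open>energy_cone\<close> delivers the constant.\<close>
  have "P = h / tau (h / r)" unfolding P_def using Pi0_eq[OF h(1) rpos] hr' by simp
  also have "\<dots> = r / cosh (tau (h / r))"
  proof -
    have "h = tau (h / r) * r / cosh (tau (h / r))" using T(2) rpos by (simp add: divide_simps mult.commute)
    then show ?thesis using T(1) by (metis less_irrefl nonzero_mult_div_cancel_left times_divide_eq_right)
  qed
  finally have P: "P = r / cosh (tau (h / r))" .
  have "f x / cosh t = P"
    unfolding t_def P using energy_cone(2)[OF _ f pos J[OF in_cone] _ x] h(1) r eq calib_zero by simp
  then have fx: "f x = P * cosh t" by auto
  have "P > 0" unfolding P using rpos by simp
  \<comment> \<open>Multiplying this ratio by f x = P cosh t gives x = P t, so the constant waist
    fixes t and hence f x.\<close>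
  have "x / f x = t / cosh t"
    using tau_props(1)[OF J[OF in_cone x]] by (simp add: kappa_def t_def)
  then have "x / P = t" using \<open>P > 0\<close> unfolding fx by (simp add: divide_simps mult.commute)
  then show "f x = rho0 h r x" unfolding rho0_def P_def[symmetric] fx by simp
qed

section \<open>The catenary's energy and the joining of the two halves\<close>

lemma energy_reflect:
  "energy 0 h (\<lambda>x. f (- x)) (\<lambda>x. - g (- x)) = energy (- h) 0 f g"
  using Henstock_Kurzweil_Integration.integral_reflect_real[of h 0 "\<lambda>x. f (- x) * sqrt (1 + (- g (- x))\<^sup>2)"]
  by (simp add: energy_def)

lemma weak_deriv_has_ac_deriv:
  assumes "W11 a b f"
  shows "has_ac_deriv f (weak_deriv a b f) a b"
  using someI_ex[OF assms[unfolded W11_def]] unfolding has_ac_deriv_def weak_deriv_def .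

lemma E0_eq_energy: "E0 h f = energy (- h) h f (weak_deriv (- h) h f)"
  by (simp add: E0_def energy_def)

lemma catenary_has_ac_deriv:
  assumes "P > 0"
  shows "has_ac_deriv (\<lambda>x. P * cosh (x / P)) (\<lambda>x. sinh (x / P)) a b"
  using assms by (intro has_ac_deriv_smooth) (auto intro!: derivative_eq_intros continuous_intros)

lemma catenary_energy:
  assumes "P > 0" "h > 0"
  shows "energy (- h) h (\<lambda>x. P * cosh (x / P)) (\<lambda>x. sinh (x / P)) =
    2 * ((P * cosh (h / P))\<^sup>2 * half_area (h / P))"
proof -
  \<comment> \<open>An antiderivative of P cosh^2 (x / P), which is the energy density because sqrt
    (1 + sinh^2) = cosh.\<close>
  define A where "A x = P\<^sup>2 * (x / P + sinh (x / P) * cosh (x / P)) / 2" for x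
  have deriv: "(A has_real_derivative P * cosh (x / P) * sqrt (1 + (sinh (x / P))\<^sup>2)) (at x within S)" for x S
  proof -
    have s: "sqrt (1 + (sinh (x / P))\<^sup>2) = cosh (x / P)"
      by (rule real_sqrt_unique) (simp_all add: cosh_square_eq)
    have c: "1 + sinh (x / P) * sinh (x / P) = cosh (x / P) * cosh (x / P)"
      using cosh_square_eq[of "x / P"] by (simp add: power2_eq_square)
    have "(A has_real_derivative P\<^sup>2 * (1 / P + (cosh (x / P) * (1 / P) * cosh (x / P) +
        sinh (x / P) * (1 / P) * sinh (x / P))) / 2) (at x within S)"
      unfolding A_def[abs_def] using assms by (auto intro!: derivative_eq_intros)
    also have "P\<^sup>2 * (1 / P + (cosh (x / P) * (1 / P) * cosh (x / P) +
        sinh (x / P) * (1 / P) * sinh (x / P))) / 2 =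
        P * (1 + sinh (x / P) * sinh (x / P) + cosh (x / P) * cosh (x / P)) / 2"
      using assms by (simp add: power2_eq_square field_simps)
    also have "\<dots> = P * cosh (x / P) * sqrt (1 + (sinh (x / P))\<^sup>2)" unfolding c s by simp
    finally show ?thesis .
  qed
  have "((\<lambda>x. P * cosh (x / P) * sqrt (1 + (sinh (x / P))\<^sup>2)) has_integral (A h - A (- h))) {- h..h}"
    using assms deriv by (intro fundamental_theorem_of_calculus)
      (auto simp flip: has_real_derivative_iff_has_vector_derivative)
  then have "energy (- h) h (\<lambda>x. P * cosh (x / P)) (\<lambda>x. sinh (x / P)) = A h - A (- h)"
    unfolding energy_def by (rule integral_unique)
  also have "\<dots> = P\<^sup>2 * (h / P + sinh (h / P) * cosh (h / P))"
  proof -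
    have "A (- h) = - A h" by (simp add: A_def) (simp add: algebra_simps)
    then show ?thesis by (simp add: A_def)
  qed
  also have "\<dots> = 2 * ((P * cosh (h / P))\<^sup>2 * half_area (h / P))"
    by (simp add: half_area_def power_mult_distrib)
  finally show ?thesis .
qed

theorem theorem3p3:
  fixes h r :: real
  assumes "h > 0" and "r > 0" and "h / r \<le> omega"
  shows "rho0 h r \<in> admissible h r \<and>
         (\<forall>\<rho>\<in>admissible h r. E0 h (rho0 h r) \<le> E0 h \<rho>) \<and>
         (\<forall>\<rho>\<in>admissible h r. E0 h \<rho> = E0 h (rho0 h r) \<longrightarrow> (\<forall>x\<in>{-h..h}. \<rho> x = rho0 h r x))"
proof -
  define P t where "P = Pi0 h r" and "t = tau (h / r)"
  have hr: "h / r < kappa 1" using assms(3) omega_props(2) by linarith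
  then have u: "h / r \<in> {- kappa 1<..<kappa 1}" using assms cone_interval[of h r]
    by (simp add: pos_divide_le_eq)
  have t: "t > 0" "t / cosh t = h / r"
    using tau_pos[of "h / r"] tau_props(1)[OF u] hr assms by (auto simp: t_def kappa_def)
  have P: "P = h / t" unfolding P_def t_def by (rule Pi0_eq[OF assms(1,2) hr])
  have Ppos: "P > 0" and hP: "h / P = t" using t(1) assms(1) by (auto simp: P)
  have r: "P * cosh t = r" using t assms unfolding P by (simp add: divide_simps mult.commute)
  have rho0: "rho0 h r = (\<lambda>x. P * cosh (x / P))" by (simp add: rho0_def P_def fun_eq_iff)
  have ac: "has_ac_deriv (rho0 h r) (\<lambda>x. sinh (x / P)) (- h) h"
    unfolding rho0 by (rule catenary_has_ac_deriv[OF Ppos])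
  have W: "W11 (- h) h (rho0 h r)"
    using ac unfolding has_ac_deriv_def W11_def by blast
  have adm: "rho0 h r \<in> admissible h r"
    using W Ppos r hP by (simp add: admissible_def) (simp add: rho0)
  have E_rho0: "E0 h (rho0 h r) = 2 * calib h r"
  proof -
    have "E0 h (rho0 h r) = energy (- h) h (rho0 h r) (\<lambda>x. sinh (x / P))"
      unfolding E0_eq_energy using assms(1)
      by (intro energy_cong_negligible has_ac_deriv_unique[OF _ weak_deriv_has_ac_deriv[OF W] ac]) simp
    then show ?thesis
      using catenary_energy[OF Ppos assms(1)] unfolding rho0 hP r calib_def t_def[symmetric] by simp
  qed
  have key: "2 * calib h r \<le> E0 h \<rho> \<and>
      (E0 h \<rho> = 2 * calib h r \<longrightarrow> (\<forall>x\<in>{-h..h}. \<rho> x = rho0 h r x))" if "\<rho> \<in> admissible h r" for \<rho>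
  proof -
    define g where "g = weak_deriv (- h) h \<rho>"
    have \<rho>: "W11 (- h) h \<rho>" "\<And>x. x \<in> {- h..h} \<Longrightarrow> \<rho> x > 0" "\<rho> (- h) = r" "\<rho> h = r"
      using that by (auto simp: admissible_def)
    have g: "has_ac_deriv \<rho> g (- h) h" unfolding g_def by (rule weak_deriv_has_ac_deriv[OF \<rho>(1)])
    have right: "has_ac_deriv \<rho> g 0 h"
      using assms(1) by (intro has_ac_deriv_subinterval[OF g]) auto
    have left: "has_ac_deriv (\<lambda>x. \<rho> (- x)) (\<lambda>x. - g (- x)) 0 h"
      using assms(1) by (intro has_ac_deriv_reflect has_ac_deriv_subinterval[OF g]) auto
    have E: "E0 h \<rho> = energy 0 h (\<lambda>x. \<rho> (- x)) (\<lambda>x. - g (- x)) + energy 0 h \<rho> g"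
      unfolding E0_eq_energy energy_reflect g_def[symmetric] using assms(1)
      by (intro energy_split[OF g]) auto
    have pos: "\<And>x. x \<in> {0..h} \<Longrightarrow> \<rho> x > 0" "\<And>x. x \<in> {0..h} \<Longrightarrow> \<rho> (- x) > 0"
      using \<rho>(2) by auto
    note R = half_energy[OF assms(1,3) right pos(1) \<rho>(4)]
    note L = half_energy[OF assms(1,3) left pos(2) \<rho>(3)]
    have "\<rho> x = rho0 h r x" if eq: "E0 h \<rho> = 2 * calib h r" and x: "x \<in> {- h..h}" for x
    proof (cases "x \<ge> 0")
      case True
      \<comment> \<open>Each half costs at least calib h r, so equality of the sum forces equality
        in both halves.\<close>
      have "energy 0 h \<rho> g = calib h r" using E eq L(1) R(1) by linarith
      then show ?thesis using R(2)[of x] x True by simp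
    next
      case False
      have "energy 0 h (\<lambda>x. \<rho> (- x)) (\<lambda>x. - g (- x)) = calib h r" using E eq L(1) R(1) by linarith
      then have "\<rho> x = rho0 h r (- x)" using L(2)[of "- x"] x False by simp
      then show ?thesis by (simp add: rho0_def)
    qed
    then show ?thesis using E L(1) R(1) by auto
  qed
  show ?thesis using adm key unfolding E_rho0 by blast
qed

end
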